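(* Let $\alpha\in(0,1]$, $p,q>0$ and $\gamma,\beta,\delta,\rho\in\mathbb{C}$ with $\mathrm{Re}(\gamma)>0$, $\mathrm{Re}(\beta)>0$, $\mathrm{Re}(\delta)>0$, $\mathrm{Re}(\rho)>0$ and $\mathrm{Re}(\gamma)+p\ge q$. Let $\mathcal{V}$ denote the truncated $\mathcal{V}$-fractional derivative of order $\alpha$ with these parameters, and $K=\dfrac{\Gamma(\gamma+\beta)(\delta)_p}{\Gamma(\beta)(\rho)_q}$. Let $n\ge -1$ be an integer, let $f:[0,\infty)\to\mathbb{R}$ be $(n+1)$ times $\alpha$-differentiable on $[0,\infty)$, and let $0\le a\le t\le b$. Then $$\int_{a}^{b}\frac{\mathcal{V}^{n+1}f(s)}{(n+1)!}\left(K\,\frac{t^\alpha-s^\alpha}{\alpha}\right)^{n+1}d_\omega s=\int_{a}^{t}R_{n,f}(a,s)\,d_\omega s+\int_{t}^{b}R_{n,f}(b,s)\,d_\omega s .$$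
   Context: Parameters as in the claim, with a truncation index $i$ (a positive integer). Put $(\rho)_{qk}=\Gamma(\rho+qk)/\Gamma(\rho)$, $(\delta)_{pk}=\Gamma(\delta+pk)/\Gamma(\delta)$, and $$H(z)=\Gamma(\beta)\sum_{k=0}^{i}\frac{(\rho)_{qk}}{(\delta)_{pk}}\frac{z^k}{\Gamma(\gamma k+\beta)}.$$ Truncated $\mathcal{V}$-fractional derivative of order $\alpha\in(0,1]$: for $f:[0,\infty)\to\mathbb{R}$ and $t>0$, $$\mathcal{V}f(t)=\lim_{\epsilon\to0}\frac{f\big(t\,H(\epsilon t^{-\alpha})\big)-f(t)}{\epsilon},$$ and $\mathcal{V}f(0)=\lim_{t\to0^+}\mathcal{V}f(t)$ when this limit exists. (Since $f$ is real-valued on $[0,\infty)$, the definition presupposes that $t\,H(\epsilon t^{-\alpha})\in[0,\infty)$ for all sufficiently small real $\epsilon$.) $f$ is called $\alpha$-differentiable where this exists. Iterates: $\mathcal{V}^0f=f$, $\mathcal{V}^{n}f=\mathcal{V}^{n-1}(\mathcal{V}f)$. $\mathcal{V}$-fractional integral: $\displaystyle\int_a^b f(x)\,d_\omega x:=K\int_a^b f(x)\,x^{\alpha-1}\,dx$ with $K$ as in the claim. Remainder function: $R_{-1,f}(\cdot,s):=f(s)$, and for $n\ge0$, $$R_{n,f}(t,s):=f(s)-\sum_{k=0}^{n}\frac{\mathcal{V}^{k}f(t)}{k!}\left(K\,\frac{s^\alpha-t^\alpha}{\alpha}\right)^{k}.$$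
   Formalization: For n ≥ 0 and a = 0, f is additionally assumed right-continuous at 0 (a jump of f at 0 makes the identity false); for n = −1, the fractional integral of f over [a,b] is assumed to exist. *)

theory Defs
  imports "HOL-Analysis.Analysis"
begin

text \<open>
  The library's \<open>pochhammer\<close> only takes natural-number indices; here the index is real,
  and $(a)_x = \Gamma(a+x)/\Gamma(a)$.
\<close>

definition gen_poch :: "complex \<Rightarrow> real \<Rightarrow> complex" where
  "gen_poch a x = Gamma (a + of_real x) / Gamma a"

definition V_kernel ::
  "nat \<Rightarrow> real \<Rightarrow> real \<Rightarrow> complex \<Rightarrow> complex \<Rightarrow> complex \<Rightarrow> complex \<Rightarrow> complex \<Rightarrow> complex" where
  "V_kernel i p q \<gamma> \<beta> \<delta> \<rho> z =
     Gamma \<beta> * (\<Sum>k=0..i. gen_poch \<rho> (q * real k) / gen_poch \<delta> (p * real k)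
                          * (z ^ k / Gamma (\<gamma> * of_nat k + \<beta>)))"

definition V_const ::
  "real \<Rightarrow> real \<Rightarrow> complex \<Rightarrow> complex \<Rightarrow> complex \<Rightarrow> complex \<Rightarrow> complex" where
  "V_const p q \<gamma> \<beta> \<delta> \<rho> =
     (Gamma (\<gamma> + \<beta>) * gen_poch \<delta> p) / (Gamma \<beta> * gen_poch \<rho> q)"

text \<open>
  Below, \<open>H\<close> stands for a kernel \<open>V_kernel i p q \<gamma> \<beta> \<delta> \<rho>\<close>, and a function on $[0,\infty)$ is
  represented by a total function whose values at negative arguments play no role.
\<close>

definition V_point :: "real \<Rightarrow> (complex \<Rightarrow> complex) \<Rightarrow> real \<Rightarrow> real \<Rightarrow> complex" where
  "V_point \<alpha> H t \<epsilon> = of_real t * H (of_real (\<epsilon> * t powr (- \<alpha>)))"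

definition V_quot :: "real \<Rightarrow> (complex \<Rightarrow> complex) \<Rightarrow> (real \<Rightarrow> real) \<Rightarrow> real \<Rightarrow> real \<Rightarrow> real" where
  "V_quot \<alpha> H f t \<epsilon> = (f (Re (V_point \<alpha> H t \<epsilon>)) - f t) / \<epsilon>"

text \<open>
  The first conjunct says that the evaluation point, a priori complex, lies in the domain
  $[0,\infty)$ of \<open>f\<close> for all small \<open>\<epsilon>\<close>; there the real part in \<open>V_quot\<close> is the point itself.
\<close>

definition has_V_deriv_pos ::
  "real \<Rightarrow> (complex \<Rightarrow> complex) \<Rightarrow> (real \<Rightarrow> real) \<Rightarrow> real \<Rightarrow> real \<Rightarrow> bool" where
  "has_V_deriv_pos \<alpha> H f t D \<longleftrightarrow>
     (\<forall>\<^sub>F \<epsilon> in at 0. V_point \<alpha> H t \<epsilon> \<in> \<real>\<^sub>\<ge>\<^sub>0) \<and>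
     ((V_quot \<alpha> H f t) \<longlongrightarrow> D) (at 0)"

text \<open>
  The value at 0 is a limit of values at positive points, so differentiability at 0 says nothing
  about \<open>f 0\<close>: a function may be differentiable on $[0,\infty)$ and have a jump at 0.
\<close>

definition V_deriv :: "real \<Rightarrow> (complex \<Rightarrow> complex) \<Rightarrow> (real \<Rightarrow> real) \<Rightarrow> real \<Rightarrow> real" where
  "V_deriv \<alpha> H f t =
     (if t = 0 then Lim (at_right 0) (\<lambda>u. Lim (at 0) (V_quot \<alpha> H f u))
      else Lim (at 0) (V_quot \<alpha> H f t))"

definition V_differentiable_at ::
  "real \<Rightarrow> (complex \<Rightarrow> complex) \<Rightarrow> (real \<Rightarrow> real) \<Rightarrow> real \<Rightarrow> bool" where
  "V_differentiable_at \<alpha> H f t \<longleftrightarrow>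
     (if t = 0 then
        (\<forall>\<^sub>F u in at_right 0. \<exists>D. has_V_deriv_pos \<alpha> H f u D) \<and>
        (\<exists>D. ((\<lambda>u. V_deriv \<alpha> H f u) \<longlongrightarrow> D) (at_right 0))
      else \<exists>D. has_V_deriv_pos \<alpha> H f t D)"

definition V_differentiable_times ::
  "nat \<Rightarrow> real \<Rightarrow> (complex \<Rightarrow> complex) \<Rightarrow> (real \<Rightarrow> real) \<Rightarrow> bool" where
  "V_differentiable_times m \<alpha> H f \<longleftrightarrow>
     (\<forall>k<m. \<forall>t\<ge>0. V_differentiable_at \<alpha> H ((V_deriv \<alpha> H ^^ k) f) t)"

text \<open>
  The constant \<open>K\<close> is formally complex, so integrands and remainders are complex valued.
  The integral is the Henstock--Kurzweil one, so it also covers improper integrals at 0.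
\<close>

definition omega_integrable :: "real \<Rightarrow> real \<Rightarrow> real \<Rightarrow> (real \<Rightarrow> complex) \<Rightarrow> bool" where
  "omega_integrable \<alpha> a b g \<longleftrightarrow> (\<lambda>x. g x * of_real (x powr (\<alpha> - 1))) integrable_on {a..b}"

definition omega_integral ::
  "complex \<Rightarrow> real \<Rightarrow> real \<Rightarrow> real \<Rightarrow> (real \<Rightarrow> complex) \<Rightarrow> complex" where
  "omega_integral K \<alpha> a b g = K * integral {a..b} (\<lambda>x. g x * of_real (x powr (\<alpha> - 1)))"

definition V_remainder ::
  "complex \<Rightarrow> real \<Rightarrow> (complex \<Rightarrow> complex) \<Rightarrow> int \<Rightarrow> (real \<Rightarrow> real) \<Rightarrow> real \<Rightarrow> real \<Rightarrow> complex" where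
  "V_remainder K \<alpha> H n f t s =
     (if n = -1 then of_real (f s)
      else of_real (f s) -
        (\<Sum>k=0..nat n. of_real ((V_deriv \<alpha> H ^^ k) f t) / fact k
           * (K * of_real ((s powr \<alpha> - t powr \<alpha>) / \<alpha>)) ^ k))"

end

theory Submission
  imports Defs
begin

text \<open>
  The kernel satisfies $H(0)=1$ and $H'(0)=1/K$. As soon as one derivative exists, \<open>H\<close> is real on
  small reals, so \<open>K\<close> is real; at $t>0$ the evaluation point then sweeps out a neighbourhood of
  $t$ with speed $t^{1-\alpha}/K$, and every $\mathcal{V}$-differentiable function is differentiable
  on $(0,\infty)$ with $f' = K t^{\alpha-1}\,\mathcal{V}f$. Put $X(s) = K s^\alpha/\alpha$ and
  $P(s) = \sum_{k\le n} \mathcal{V}^k f(s)\,(X(t)-X(s))^{k+1}/(k+1)!$. Both sides of the identity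
  equal $P(b) - P(a) + \int_a^b f\,d_\omega$: on the right one integrates the Taylor polynomials
  termwise, on the left the derivative of \<open>P\<close> telescopes.
\<close>

section \<open>Ordinary derivatives from difference quotients along a curve\<close>

text \<open>By the intermediate value theorem, the nonzero derivative makes \<open>\<phi>\<close>
  map every small interval around \<open>x\<close> onto a set containing a neighbourhood of
  \<open>\<phi> x\<close>. A limit taken along \<open>\<phi>\<close> is therefore a genuine limit at
  \<open>\<phi> x\<close>.\<close>

lemma at_le_filtermap_at_of_DERIV:
  fixes \<phi> :: "real \<Rightarrow> real"
  assumes cont: "continuous_on UNIV \<phi>"
    and der: "(\<phi> has_real_derivative c) (at x)" and "c \<noteq> 0"
  shows "at (\<phi> x) \<le> filtermap \<phi> (at x)"
proof (rule filter_leI)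
  fix P assume "eventually P (filtermap \<phi> (at x))"
  then obtain d where "d > 0" and d: "\<And>y. y \<noteq> x \<Longrightarrow> dist y x < d \<Longrightarrow> P (\<phi> y)"
    by (auto simp: eventually_filtermap eventually_at)
  let ?S = "{x - d/2..x + d/2}"
  \<comment> \<open>The radius \<open>d/2\<close> keeps the closed interval inside the open
    \<open>d\<close>-ball on which \<open>P (\<phi> y)\<close> is known away from \<open>x\<close>.
    The sign of \<open>c\<close> only decides on which side of \<open>x\<close> the smaller value
    lies.\<close>
  have "\<exists>y\<in>?S. \<exists>z\<in>?S. \<phi> y < \<phi> x \<and> \<phi> x < \<phi> z"
  proof (cases "c > 0")
    case True
    obtain d1 where d1: "d1 > 0" "\<forall>h>0. h < d1 \<longrightarrow> \<phi> x < \<phi> (x + h)"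
      using DERIV_pos_inc_right[OF der True] by blast
    obtain d2 where d2: "d2 > 0" "\<forall>h>0. h < d2 \<longrightarrow> \<phi> (x - h) < \<phi> x"
      using DERIV_pos_inc_left[OF der True] by blast
    define h where "h = min (d/2) (min (d1/2) (d2/2))"
    have "h > 0" "h < d1" "h < d2" "h \<le> d/2" using d1 d2 \<open>d > 0\<close> by (auto simp: h_def)
    then show ?thesis using d1 d2 by (intro bexI[of _ "x - h"] bexI[of _ "x + h"]) auto
  next
    case False
    with \<open>c \<noteq> 0\<close> have "c < 0" by simp
    obtain d1 where d1: "d1 > 0" "\<forall>h>0. h < d1 \<longrightarrow> \<phi> x > \<phi> (x + h)"
      using DERIV_neg_dec_right[OF der \<open>c < 0\<close>] by blast
    obtain d2 where d2: "d2 > 0" "\<forall>h>0. h < d2 \<longrightarrow> \<phi> (x - h) > \<phi> x"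
      using DERIV_neg_dec_left[OF der \<open>c < 0\<close>] by blast
    define h where "h = min (d/2) (min (d1/2) (d2/2))"
    have "h > 0" "h < d1" "h < d2" "h \<le> d/2" using d1 d2 \<open>d > 0\<close> by (auto simp: h_def)
    then show ?thesis using d1 d2 by (intro bexI[of _ "x + h"] bexI[of _ "x - h"]) auto
  qed
  then obtain y z where yz: "y \<in> ?S" "z \<in> ?S" "\<phi> y < \<phi> x" "\<phi> x < \<phi> z" by blast
  have "connected (\<phi> ` ?S)"
    by (intro connected_continuous_image continuous_on_subset[OF cont]) auto
  then have sub: "{\<phi> y..\<phi> z} \<subseteq> \<phi> ` ?S"
    using yz by (intro connected_contains_Icc) auto
  have P: "P u" if u: "u \<in> {\<phi> y<..<\<phi> z}" "u \<noteq> \<phi> x" for u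
  proof -
    have "u \<in> \<phi> ` ?S" using sub u by auto
    then obtain v where "v \<in> ?S" "u = \<phi> v" by blast
    moreover from this have "v \<noteq> x" using u by auto
    ultimately show ?thesis using d[of v] \<open>d > 0\<close> by (auto simp: dist_real_def)
  qed
  have "eventually (\<lambda>u. u \<in> {\<phi> y<..<\<phi> z}) (nhds (\<phi> x))"
    using yz by (intro eventually_nhds_in_open) auto
  then show "eventually P (at (\<phi> x))"
    unfolding eventually_at_filter by eventually_elim (use P in auto)
qed

text \<open>This is the chain rule read backwards: dividing the quotient along \<open>\<phi>\<close>
  by that of \<open>\<phi>\<close> gives the difference quotient of \<open>f\<close> at the points
  \<open>\<phi> \<epsilon>\<close>, and these fill a neighbourhood of
  \<open>\<phi> 0\<close>.\<close>

lemma DERIV_of_tendsto_along: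
  fixes f \<phi> :: "real \<Rightarrow> real"
  assumes "continuous_on UNIV \<phi>"
    and der: "(\<phi> has_real_derivative c) (at 0)" and "c \<noteq> 0"
    and lim: "((\<lambda>\<epsilon>. (f (\<phi> \<epsilon>) - f (\<phi> 0)) / \<epsilon>) \<longlongrightarrow> D) (at 0)"
  shows "(f has_real_derivative D / c) (at (\<phi> 0))"
proof -
  let ?q = "\<lambda>\<epsilon>. (\<phi> \<epsilon> - \<phi> 0) / \<epsilon>"
  have q: "(?q \<longlongrightarrow> c) (at 0)"
    using der by (simp add: has_field_derivative_iff)
  have "((\<lambda>\<epsilon>. (f (\<phi> \<epsilon>) - f (\<phi> 0)) / \<epsilon> / ?q \<epsilon>) \<longlongrightarrow> D / c) (at 0)"
    by (intro tendsto_divide lim q) fact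
  \<comment> \<open>If \<open>\<phi> \<epsilon> = \<phi> 0\<close>, both sides are 0.\<close>
  moreover have "\<forall>\<^sub>F \<epsilon> in at 0. (f (\<phi> \<epsilon>) - f (\<phi> 0)) / \<epsilon> / ?q \<epsilon>
      = (f (\<phi> \<epsilon>) - f (\<phi> 0)) / (\<phi> \<epsilon> - \<phi> 0)"
    unfolding eventually_at_filter by (rule always_eventually) auto
  ultimately have "((\<lambda>\<epsilon>. (f (\<phi> \<epsilon>) - f (\<phi> 0)) / (\<phi> \<epsilon> - \<phi> 0)) \<longlongrightarrow> D / c) (at 0)"
    by (rule Lim_transform_eventually)
  then have "((\<lambda>y. (f y - f (\<phi> 0)) / (y - \<phi> 0)) \<longlongrightarrow> D / c) (filtermap \<phi> (at 0))"
    by (simp add: filterlim_filtermap)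
  then have "((\<lambda>y. (f y - f (\<phi> 0)) / (y - \<phi> 0)) \<longlongrightarrow> D / c) (at (\<phi> 0))"
    by (rule tendsto_mono[OF at_le_filtermap_at_of_DERIV[OF assms(1-3)]])
  then show ?thesis by (simp add: has_field_derivative_iff)
qed

section \<open>The kernel near 0\<close>

context
  fixes p q :: real and \<gamma> \<beta> \<delta> \<rho> :: complex
  assumes pq: "0 < p" "0 < q"
    and re: "0 < Re \<gamma>" "0 < Re \<beta>" "0 < Re \<delta>" "0 < Re \<rho>"
begin

lemma Gamma_Re_pos_nonzero: "0 < Re z \<Longrightarrow> Gamma z \<noteq> 0"
  by (auto simp: Gamma_eq_zero_iff elim!: nonpos_Ints_cases)

lemma V_const_nonzero: "V_const p q \<gamma> \<beta> \<delta> \<rho> \<noteq> 0"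
  using pq re by (simp add: V_const_def gen_poch_def Gamma_Re_pos_nonzero)

lemma V_kernel_0: "V_kernel i p q \<gamma> \<beta> \<delta> \<rho> 0 = 1"
  using re by (simp add: V_kernel_def gen_poch_def Gamma_Re_pos_nonzero power_0_left
      if_distrib[of "\<lambda>x. _ * x"] if_distrib[of "\<lambda>x. x / _"] cong: if_cong)

lemma continuous_on_V_kernel: "continuous_on UNIV (V_kernel i p q \<gamma> \<beta> \<delta> \<rho>)"
  unfolding V_kernel_def
  by (intro continuous_intros) (use re in \<open>auto simp: Gamma_Re_pos_nonzero add_nonneg_pos\<close>)

text \<open>The constant K is the reciprocal of the linear coefficient of the kernel polynomial;
  \<open>0 < i\<close> ensures that the truncated sum contains this term.\<close>

lemma DERIV_V_kernel_0:
  assumes "0 < i"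
  shows "(V_kernel i p q \<gamma> \<beta> \<delta> \<rho> has_field_derivative 1 / V_const p q \<gamma> \<beta> \<delta> \<rho>) (at 0)"
proof -
  define c where "c k = Gamma \<beta> * (gen_poch \<rho> (q * real k) / gen_poch \<delta> (p * real k)
    / Gamma (\<gamma> * of_nat k + \<beta>))" for k
  have "V_kernel i p q \<gamma> \<beta> \<delta> \<rho> = (\<lambda>z. \<Sum>k=0..i. c k * z ^ k)"
    by (simp add: V_kernel_def c_def sum_distrib_left fun_eq_iff mult_ac)
  moreover have "((\<lambda>z. \<Sum>k=0..i. c k * z ^ k) has_field_derivative
      (\<Sum>k=0..i. c k * (of_nat k * 0 ^ (k - 1)))) (at 0)"
    by (auto intro!: derivative_eq_intros simp: mult_ac)
  \<comment> \<open>For \<open>k = 0\<close> truncated subtraction gives \<open>0 ^ 0 = 1\<close>,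
    but the factor \<open>of_nat 0\<close> removes the term, so only \<open>k = 1\<close>
    survives.\<close>
  moreover have "(\<Sum>k=0..i. c k * (of_nat k * 0 ^ (k - 1))) = (\<Sum>k=0..i. if k = 1 then c 1 else 0)"
    by (intro sum.cong) (auto simp: power_0_left)
  moreover have "\<dots> = c 1" using assms by simp
  moreover have "c 1 = 1 / V_const p q \<gamma> \<beta> \<delta> \<rho>" by (simp add: c_def V_const_def)
  ultimately show ?thesis by simp
qed

end

section \<open>From V-derivatives to ordinary derivatives\<close>

text \<open>At \<open>t = 1\<close> the evaluation point is \<open>H \<epsilon>\<close> itself, so
  the domain condition makes the difference quotients of \<open>H\<close> along the reals real, and
  the reals are closed in the complex plane.\<close>

lemma has_V_deriv_pos_imp_Real:
  assumes "has_V_deriv_pos \<alpha> H f 1 D" "H 0 = 1" and der: "(H has_field_derivative c) (at 0)"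
  shows "c \<in> \<real>"
proof -
  have "((\<lambda>z. (H z - 1) / z) \<longlongrightarrow> c) (at 0)"
    using der assms(2) by (simp add: has_field_derivative_iff)
  moreover have "filterlim complex_of_real (at 0) (at 0)"
    by (auto simp: filterlim_at eventually_at_filter intro!: tendsto_eq_intros)
  ultimately have "((\<lambda>\<epsilon>. (H (of_real \<epsilon>) - 1) / of_real \<epsilon>) \<longlongrightarrow> c) (at (0::real))"
    by (rule filterlim_compose)
  moreover have "\<forall>\<^sub>F \<epsilon> in at (0::real). (H (of_real \<epsilon>) - 1) / of_real \<epsilon> \<in> \<real>"
    using assms(1) unfolding has_V_deriv_pos_def V_point_def
    by (auto elim!: eventually_mono simp: nonneg_Reals_subset_Reals[THEN subsetD])
  ultimately show ?thesis
    using Lim_in_closed_set[OF closed_complex_Reals, of _ "at (0::real)" c] by simp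
qed

text \<open>The evaluation point, as a function of \<open>\<epsilon>\<close>, passes through
  \<open>t\<close> with speed \<open>t powr (1 - \<alpha>) / \<kappa>\<close>, and
  \<open>V_quot\<close> is the quotient of \<open>f\<close> along this curve.\<close>

lemma has_V_deriv_pos_imp_DERIV:
  assumes "has_V_deriv_pos \<alpha> H f t D" "t > 0" "H 0 = 1" "continuous_on UNIV H"
    and der: "(H has_field_derivative of_real (1 / \<kappa>)) (at 0)" and "\<kappa> \<noteq> 0"
  shows "(f has_real_derivative D * (\<kappa> * t powr (\<alpha> - 1))) (at t)"
proof -
  let ?\<phi> = "\<lambda>\<epsilon>. Re (V_point \<alpha> H t \<epsilon>)"
  have "((\<lambda>\<epsilon>. complex_of_real (\<epsilon> * t powr - \<alpha>)) has_vector_derivative of_real (t powr - \<alpha>)) (at 0)"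
    by (intro has_vector_derivative_of_real) (auto intro!: derivative_eq_intros)
  from field_vector_diff_chain_at[OF this, of H "of_real (1 / \<kappa>)"] der
  have "((\<lambda>\<epsilon>. H (of_real (\<epsilon> * t powr - \<alpha>))) has_vector_derivative
      of_real (t powr - \<alpha>) * of_real (1 / \<kappa>)) (at 0)"
    by (simp add: o_def)
  from has_vector_derivative_mult_right[OF this, of "of_real t"]
  have "((\<lambda>\<epsilon>. of_real t * H (of_real (\<epsilon> * t powr - \<alpha>))) has_vector_derivative
      of_real (t * (t powr - \<alpha> * (1 / \<kappa>)))) (at 0)"
    by simp
  \<comment> \<open>Taking real parts keeps the value of the derivative, which is already
    real.\<close>
  then have "(?\<phi> has_real_derivative t * (t powr - \<alpha> * (1 / \<kappa>))) (at 0)"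
    unfolding V_point_def
    by (auto dest: bounded_linear.has_vector_derivative[OF bounded_linear_Re]
        simp: has_real_derivative_iff_has_vector_derivative)
  moreover have "continuous_on UNIV ?\<phi>"
    unfolding V_point_def
    by (intro continuous_intros continuous_on_compose2[OF assms(4)]) auto
  moreover have "?\<phi> 0 = t" by (simp add: V_point_def \<open>H 0 = 1\<close>)
  moreover have "(V_quot \<alpha> H f t \<longlongrightarrow> D) (at 0)"
    using assms(1) by (simp add: has_V_deriv_pos_def)
  ultimately have "(f has_real_derivative D / (t * (t powr - \<alpha> * (1 / \<kappa>)))) (at t)"
    using DERIV_of_tendsto_along[of ?\<phi> "t * (t powr - \<alpha> * (1 / \<kappa>))" f D] \<open>t > 0\<close> \<open>\<kappa> \<noteq> 0\<close>
    by (simp add: V_quot_def[abs_def])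
  also have "D / (t * (t powr - \<alpha> * (1 / \<kappa>))) = D * (\<kappa> * t powr (\<alpha> - 1))"
    using \<open>t > 0\<close> \<open>\<kappa> \<noteq> 0\<close> by (simp add: powr_minus powr_diff field_simps)
  finally show ?thesis .
qed

lemma V_differentiable_at_imp_DERIV:
  assumes "V_differentiable_at \<alpha> H f t" "t > 0" "H 0 = 1" "continuous_on UNIV H"
    and "(H has_field_derivative of_real (1 / \<kappa>)) (at 0)" and "\<kappa> \<noteq> 0"
  shows "(f has_real_derivative V_deriv \<alpha> H f t * (\<kappa> * t powr (\<alpha> - 1))) (at t)"
proof -
  obtain D where D: "has_V_deriv_pos \<alpha> H f t D"
    using assms(1,2) by (auto simp: V_differentiable_at_def)
  then have "V_deriv \<alpha> H f t = D"
    using \<open>t > 0\<close> by (auto simp: V_deriv_def has_V_deriv_pos_def intro!: tendsto_Lim)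
  with has_V_deriv_pos_imp_DERIV[OF D assms(2-)] show ?thesis by simp
qed

text \<open>The value at 0 is by definition the right-hand limit. This yields continuity at 0 of
  every iterate of positive order.\<close>

lemma V_deriv_tendsto_at_0:
  assumes "V_differentiable_at \<alpha> H f 0"
  shows "(V_deriv \<alpha> H f \<longlongrightarrow> V_deriv \<alpha> H f 0) (at_right 0)"
proof -
  obtain D where D: "(V_deriv \<alpha> H f \<longlongrightarrow> D) (at_right 0)"
    using assms by (auto simp: V_differentiable_at_def)
  have "\<forall>\<^sub>F u in at_right 0. V_deriv \<alpha> H f u = Lim (at 0) (V_quot \<alpha> H f u)"
    by (auto simp: eventually_at_filter V_deriv_def)
  with D have "((\<lambda>u. Lim (at 0) (V_quot \<alpha> H f u)) \<longlongrightarrow> D) (at_right 0)"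
    by (rule Lim_transform_eventually)
  then have "V_deriv \<alpha> H f 0 = D"
    by (auto simp: V_deriv_def intro!: tendsto_Lim)
  with D show ?thesis by simp
qed

section \<open>Integrability against the weight\<close>

text \<open>The weight may be singular at 0 but is absolutely integrable because
  \<open>\<alpha> - 1 > -1\<close>; the continuous factor is bounded on the compact
  interval.\<close>

lemma integrable_on_continuous_mult_powr:
  fixes f :: "real \<Rightarrow> real"
  assumes "0 < \<alpha>" "0 \<le> a" and cont: "continuous_on {a..b} f"
  shows "(\<lambda>s. f s * s powr (\<alpha> - 1)) integrable_on {a..b}"
proof (cases "a \<le> b")
  case True
  have "(\<lambda>s. s powr (\<alpha> - 1)) integrable_on {a..b}"
    using integrable_on_powr_from_0[of "\<alpha> - 1" b] assms True
    by (auto intro: integrable_on_subinterval)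
  then have "(\<lambda>s. s powr (\<alpha> - 1)) absolutely_integrable_on {a..b}"
    by (intro nonnegative_absolutely_integrable_1) auto
  then have "(\<lambda>s. f s * s powr (\<alpha> - 1)) absolutely_integrable_on {a..b}"
    using cont
    by (intro absolutely_integrable_bounded_measurable_product_real
        continuous_imp_measurable_on_sets_lebesgue compact_imp_bounded compact_continuous_image) auto
  then show ?thesis by (rule set_lebesgue_integral_eq_integral(1))
qed auto

section \<open>Integrated Taylor polynomials in the variable X\<close>

text \<open>As a function of \<open>s\<close> this is the antiderivative, vanishing at the centre
  \<open>e\<close>, of the Taylor polynomial in \<open>X\<close> times the derivative of
  \<open>X\<close>. As a function of the centre, \<open>taylor_primitive n F X s t\<close> is the
  P(s) of the overview, with \<open>F k\<close> in the role of the k-th iterated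
  V-derivative.\<close>

definition taylor_primitive ::
  "nat \<Rightarrow> (nat \<Rightarrow> real \<Rightarrow> real) \<Rightarrow> (real \<Rightarrow> real) \<Rightarrow> real \<Rightarrow> real \<Rightarrow> real" where
  "taylor_primitive n F X e s = (\<Sum>k\<le>n. F k e / fact (Suc k) * (X s - X e) ^ Suc k)"

lemma taylor_primitive_same [simp]: "taylor_primitive n F X e e = 0"
  by (simp add: taylor_primitive_def)

lemma divide_fact_Suc_mult:
  "x / fact (Suc k) * (real (Suc k) * y) = x / fact k * (y :: real)"
  by (simp del: of_nat_Suc)

text \<open>With the centre fixed, the polynomial is integrated by the fundamental theorem and
  subtracted from the integral of \<open>F 0\<close>. Derivatives are asked for in the open interval
  only, since a power of \<open>s\<close> with exponent below 1 is not differentiable at 0.\<close>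

lemma has_integral_taylor_remainder:
  fixes F :: "nat \<Rightarrow> real \<Rightarrow> real"
  assumes "c \<le> d" "continuous_on {c..d} X"
    and X: "\<And>s. s \<in> {c<..<d} \<Longrightarrow> (X has_real_derivative w s) (at s)"
    and int: "(\<lambda>s. F 0 s * w s) integrable_on {c..d}"
  shows "((\<lambda>s. (F 0 s - (\<Sum>k\<le>n. F k e / fact k * (X s - X e) ^ k)) * w s) has_integral
      integral {c..d} (\<lambda>s. F 0 s * w s)
        - (taylor_primitive n F X e d - taylor_primitive n F X e c)) {c..d}"
proof -
  have "((\<lambda>s. (\<Sum>k\<le>n. F k e / fact k * (X s - X e) ^ k) * w s) has_integral
      taylor_primitive n F X e d - taylor_primitive n F X e c) {c..d}"
  proof (rule fundamental_theorem_of_calculus_interior[OF \<open>c \<le> d\<close>])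
    show "continuous_on {c..d} (taylor_primitive n F X e)"
      unfolding taylor_primitive_def by (intro continuous_intros assms) auto
    fix s assume s: "s \<in> {c<..<d}"
    have "(taylor_primitive n F X e has_real_derivative
        (\<Sum>k\<le>n. F k e / fact (Suc k) * (real (Suc k) * ((X s - X e) ^ k * w s)))) (at s)"
      unfolding taylor_primitive_def[abs_def]
      by (intro DERIV_sum DERIV_cmult DERIV_power_Suc[THEN DERIV_cong])
        (auto intro!: derivative_eq_intros X[OF s])
    also have "(\<Sum>k\<le>n. F k e / fact (Suc k) * (real (Suc k) * ((X s - X e) ^ k * w s)))
        = (\<Sum>k\<le>n. F k e / fact k * (X s - X e) ^ k) * w s"
      unfolding divide_fact_Suc_mult sum_distrib_right by (simp add: mult_ac)
    finally show "(taylor_primitive n F X e has_vector_derivative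
        (\<Sum>k\<le>n. F k e / fact k * (X s - X e) ^ k) * w s) (at s)"
      by (simp add: has_real_derivative_iff_has_vector_derivative)
  qed
  from has_integral_diff[OF integrable_integral[OF int] this] show ?thesis
    by (simp add: left_diff_distrib)
qed

text \<open>Differentiating the primitive in its centre \<open>e\<close> makes the sum telescope.\<close>

lemma has_integral_highest_taylor_term:
  fixes F :: "nat \<Rightarrow> real \<Rightarrow> real"
  assumes "a \<le> b" "continuous_on {a..b} X"
    and X: "\<And>s. s \<in> {a<..<b} \<Longrightarrow> (X has_real_derivative w s) (at s)"
    and cont: "\<And>k. k \<le> n \<Longrightarrow> continuous_on {a..b} (F k)"
    and F: "\<And>k s. k \<le> n \<Longrightarrow> s \<in> {a<..<b} \<Longrightarrow> (F k has_real_derivative F (Suc k) s * w s) (at s)"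
    and int: "(\<lambda>s. F 0 s * w s) integrable_on {a..b}"
  shows "((\<lambda>s. F (Suc n) s / fact (Suc n) * (X t - X s) ^ Suc n * w s) has_integral
      integral {a..b} (\<lambda>s. F 0 s * w s)
        + (taylor_primitive n F X b t - taylor_primitive n F X a t)) {a..b}"
proof -
  \<comment> \<open>\<open>A k s\<close> is the k-th Taylor term centred at \<open>s\<close> and
    evaluated at \<open>t\<close>; by the product rule, the k-th summand of the primitive has
    derivative \<open>(A (Suc k) s - A k s) * w s\<close>.\<close>
  define A where "A k s = F k s / fact k * (X t - X s) ^ k" for k s
  have "((\<lambda>s. (A (Suc n) s - F 0 s) * w s) has_integral
      taylor_primitive n F X b t - taylor_primitive n F X a t) {a..b}"
  proof (rule fundamental_theorem_of_calculus_interior[OF \<open>a \<le> b\<close>])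
    show "continuous_on {a..b} (\<lambda>e. taylor_primitive n F X e t)"
      unfolding taylor_primitive_def by (intro continuous_intros assms cont) auto
    fix s assume s: "s \<in> {a<..<b}"
    have "((\<lambda>e. taylor_primitive n F X e t) has_real_derivative
        (\<Sum>k\<le>n. F (Suc k) s * w s / fact (Suc k) * (X t - X s) ^ Suc k
          + F k s / fact (Suc k) * (real (Suc k) * ((X t - X s) ^ k * - w s)))) (at s)"
      unfolding taylor_primitive_def[abs_def]
    proof (rule DERIV_sum)
      fix k assume "k \<in> {..n}"
      then have Fk: "(F k has_real_derivative F (Suc k) s * w s) (at s)" using F s by simp
      have Xk: "((\<lambda>e. (X t - X e) ^ Suc k) has_real_derivative
          real (Suc k) * ((X t - X s) ^ k * - w s)) (at s)"
        by (rule DERIV_power_Suc[THEN DERIV_cong]) (auto intro!: derivative_eq_intros X[OF s])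
      from DERIV_mult[OF DERIV_cdivide[OF Fk, of "fact (Suc k)"] Xk]
      show "((\<lambda>e. F k e / fact (Suc k) * (X t - X e) ^ Suc k) has_real_derivative
          F (Suc k) s * w s / fact (Suc k) * (X t - X s) ^ Suc k
            + F k s / fact (Suc k) * (real (Suc k) * ((X t - X s) ^ k * - w s))) (at s)"
        by (simp add: mult_ac)
    qed
    also have "(\<Sum>k\<le>n. F (Suc k) s * w s / fact (Suc k) * (X t - X s) ^ Suc k
          + F k s / fact (Suc k) * (real (Suc k) * ((X t - X s) ^ k * - w s)))
        = (\<Sum>k\<le>n. A (Suc k) s - A k s) * w s"
      unfolding divide_fact_Suc_mult sum_distrib_right A_def
      by (simp add: algebra_simps del: power_Suc fact_Suc)
    also have "(\<Sum>k\<le>n. A (Suc k) s - A k s) = A (Suc n) s - A 0 s"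
      by (induction n) auto
    finally show "((\<lambda>e. taylor_primitive n F X e t) has_vector_derivative
        (A (Suc n) s - F 0 s) * w s) (at s)"
      by (simp add: has_real_derivative_iff_has_vector_derivative A_def)
  qed
  \<comment> \<open>The telescoped derivative is the highest term minus \<open>F 0\<close>, times
    the weight; adding back the integral of \<open>F 0\<close> isolates the highest term.\<close>
  from has_integral_add[OF integrable_integral[OF int] this] show ?thesis
    by (simp add: left_diff_distrib A_def)
qed

section \<open>Passage to the complex-valued V-integral\<close>

text \<open>The real computations put the factor \<open>\<kappa>\<close> into the weight, whereas
  \<open>omega_integral\<close> has it outside the integral; linearity moves it across.\<close>

lemma has_integral_weighted_imp_omega:
  assumes "((\<lambda>s. h s * (\<kappa> * s powr (\<alpha> - 1))) has_integral I) {c..d}" "\<kappa> \<noteq> 0"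
    and "\<And>s. u s = complex_of_real (h s)"
  shows "omega_integrable \<alpha> c d u" "omega_integral (of_real \<kappa>) \<alpha> c d u = of_real I"
proof -
  have "((\<lambda>s. of_real (1 / \<kappa> * (h s * (\<kappa> * s powr (\<alpha> - 1)))) :: complex) has_integral
      of_real (1 / \<kappa> * I)) {c..d}"
    by (intro has_integral_of_real has_integral_mult_right assms)
  then have *: "((\<lambda>s. u s * of_real (s powr (\<alpha> - 1))) has_integral of_real (1 / \<kappa> * I)) {c..d}"
    using assms(2,3) by simp
  then show "omega_integrable \<alpha> c d u"
    by (auto simp: omega_integrable_def)
  show "omega_integral (of_real \<kappa>) \<alpha> c d u = of_real I"
    using integral_unique[OF *] assms(2) by (simp add: omega_integral_def)
qed

section \<open>The identity, for n = -1 and for n >= 0\<close>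

text \<open>For \<open>n = -1\<close> no regularity of \<open>f\<close> is given, so integrability
  is assumed. For \<open>n \<ge> 0\<close> and \<open>a = 0\<close>, a jump of \<open>f\<close> at 0
  would alter the remainder centred at 0 but not the left side, hence the assumption of continuity
  there. Integrability is part of the conclusion because \<open>integral\<close> returns 0 on
  non-integrable functions.\<close>

theorem lemma1:
  fixes \<alpha> p q a b t :: real
    and \<gamma> \<beta> \<delta> \<rho> K :: complex
    and H :: "complex \<Rightarrow> complex"
    and i :: nat
    and n :: int
    and f :: "real \<Rightarrow> real"
    and g :: "real \<Rightarrow> complex"
  assumes "0 < \<alpha>" "\<alpha> \<le> 1" "0 < p" "0 < q" "0 < i"
    and "0 < Re \<gamma>" "0 < Re \<beta>" "0 < Re \<delta>" "0 < Re \<rho>" "q \<le> Re \<gamma> + p"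
    and H: "H = V_kernel i p q \<gamma> \<beta> \<delta> \<rho>"
    and K: "K = V_const p q \<gamma> \<beta> \<delta> \<rho>"
    and "-1 \<le> n"
    and "V_differentiable_times (nat (n + 1)) \<alpha> H f"
    and "0 \<le> a" "a \<le> t" "t \<le> b"
    and integrable: "n = -1 \<Longrightarrow> omega_integrable \<alpha> a b (\<lambda>s. of_real (f s))"
    and continuous_0: "0 \<le> n \<Longrightarrow> a = 0 \<Longrightarrow> (f \<longlongrightarrow> f 0) (at_right 0)"
    and g: "g = (\<lambda>s. of_real ((V_deriv \<alpha> H ^^ nat (n + 1)) f s) / fact (nat (n + 1))
                  * (K * of_real ((t powr \<alpha> - s powr \<alpha>) / \<alpha>)) ^ nat (n + 1))"
  shows "omega_integrable \<alpha> a b g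
       \<and> omega_integrable \<alpha> a t (V_remainder K \<alpha> H n f a)
       \<and> omega_integrable \<alpha> t b (V_remainder K \<alpha> H n f b)
       \<and> omega_integral K \<alpha> a b g
           = omega_integral K \<alpha> a t (V_remainder K \<alpha> H n f a)
             + omega_integral K \<alpha> t b (V_remainder K \<alpha> H n f b)"
proof (cases "n = -1")
  case True
  \<comment> \<open>Here \<open>g\<close> and both remainders are \<open>f\<close> itself, so the
    claim is additivity of the integral over adjacent intervals.\<close>
  have R: "V_remainder K \<alpha> H n f e = (\<lambda>s. of_real (f s))" for e
    by (simp add: V_remainder_def True fun_eq_iff)
  have "g = (\<lambda>s. of_real (f s))" using g True by simp
  moreover have int: "(\<lambda>s. complex_of_real (f s) * of_real (s powr (\<alpha> - 1))) integrable_on {a..b}"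
    using integrable[OF True] by (simp add: omega_integrable_def)
  moreover have "(\<lambda>s. complex_of_real (f s) * of_real (s powr (\<alpha> - 1))) integrable_on {a..t}"
    "(\<lambda>s. complex_of_real (f s) * of_real (s powr (\<alpha> - 1))) integrable_on {t..b}"
    using int assms(15-17) by (auto intro: integrable_on_subinterval)
  ultimately show ?thesis
    unfolding R omega_integrable_def omega_integral_def
    using Henstock_Kurzweil_Integration.integral_combine[OF assms(16,17) int]
    by (simp flip: distrib_left)
next
  case False
  define m where "m = nat n"
  have nm: "n = int m" "nat (n + 1) = Suc m" using False assms(13) by (auto simp: m_def)
  have H0: "H 0 = 1" and contH: "continuous_on UNIV H" and K0: "K \<noteq> 0"
    and derH: "(H has_field_derivative 1 / K) (at 0)"
    unfolding H K using assms(3-9)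
    by (simp_all add: V_kernel_0 continuous_on_V_kernel V_const_nonzero DERIV_V_kernel_0)
  define F where "F k = (V_deriv \<alpha> H ^^ k) f" for k
  have F0: "F 0 = f" and FS: "F (Suc k) = V_deriv \<alpha> H (F k)" for k by (simp_all add: F_def)
  have diff: "V_differentiable_at \<alpha> H (F k) s" if "k \<le> m" "0 \<le> s" for k s
    using assms(14) that by (auto simp: V_differentiable_times_def F_def nm)
  \<comment> \<open>As \<open>n \<ge> 0\<close>, at least one V-derivative exists at 1, which forces
    K to be real.\<close>
  obtain D where "has_V_deriv_pos \<alpha> H f 1 D"
    using diff[of 0 1] by (auto simp: V_differentiable_at_def F0)
  then have "1 / K \<in> \<real>" by (rule has_V_deriv_pos_imp_Real[OF _ H0 derH])
  then have "1 / (1 / K) \<in> \<real>" by (rule Reals_divide[OF Reals_1])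
  then obtain \<kappa> where \<kappa>: "K = of_real \<kappa>" by (auto elim: Reals_cases)
  with K0 have \<kappa>0: "\<kappa> \<noteq> 0" by auto
  \<comment> \<open>\<open>w\<close> is the derivative of \<open>X\<close> on the positive reals, so
    V-differentiation becomes differentiation with respect to \<open>X\<close>.\<close>
  define w where "w s = \<kappa> * s powr (\<alpha> - 1)" for s
  define X where "X s = \<kappa> * (s powr \<alpha> / \<alpha>)" for s
  have F: "(F k has_real_derivative F (Suc k) s * w s) (at s)" if "k \<le> m" "0 < s" for k s
    using V_differentiable_at_imp_DERIV[OF diff[of k s] \<open>0 < s\<close> H0 contH, of \<kappa>] derH that \<kappa> \<kappa>0
    by (simp add: w_def FS)
  \<comment> \<open>Only \<open>s = 0\<close>, possible just for \<open>a = 0\<close>, is delicate: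
    \<open>k = 0\<close> uses the assumed continuity of \<open>f\<close>, and larger
    \<open>k\<close> the definition of the V-derivative at 0 as a limit.\<close>
  have contF: "continuous_on {a..b} (F k)" if "k \<le> m" for k
  proof (rule continuous_on_eq_continuous_within[THEN iffD2], rule ballI)
    fix s assume s: "s \<in> {a..b}"
    show "continuous (at s within {a..b}) (F k)"
    proof (cases "s = 0")
      case True
      then have "a = 0" using s assms(15) by simp
      have "(F k \<longlongrightarrow> F k 0) (at_right 0)"
      proof (cases k)
        case 0
        then show ?thesis using continuous_0[OF _ \<open>a = 0\<close>] by (simp add: F0 nm(1))
      next
        case (Suc l)
        then show ?thesis using V_deriv_tendsto_at_0[OF diff[of l 0]] that by (simp add: FS)
      qed
      then have "(F k \<longlongrightarrow> F k 0) (at 0 within {0..})"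
        by (simp add: at_within_Ici_at_right)
      then show ?thesis
        unfolding True \<open>a = 0\<close> continuous_within by (rule tendsto_within_subset) auto
    next
      case False
      then have "0 < s" using s assms(15) by simp
      show ?thesis
        by (rule continuous_at_imp_continuous_at_within[OF DERIV_isCont[OF F[OF that \<open>0 < s\<close>]]])
    qed
  qed
  have contX: "continuous_on {a..b} X"
    unfolding X_def using assms(1,15) by (intro continuous_intros continuous_on_powr') auto
  have X: "(X has_real_derivative w s) (at s)" if "0 < s" for s
    unfolding X_def w_def using that assms(1) by (auto intro!: derivative_eq_intros)
  have int: "(\<lambda>s. F 0 s * w s) integrable_on {a..b}"
    using integrable_on_mult_right[OF integrable_on_continuous_mult_powr[OF assms(1,15) contF[of 0]], of \<kappa>]
    by (simp add: w_def mult_ac)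
  have int1: "(\<lambda>s. F 0 s * w s) integrable_on {a..t}" "(\<lambda>s. F 0 s * w s) integrable_on {t..b}"
    using int assms(15-17) by (auto intro: integrable_on_subinterval)
  have contX1: "continuous_on {a..t} X" "continuous_on {t..b} X"
    using contX assms(15-17) by (auto intro: continuous_on_subset)
  have X_diff: "K * of_real ((u powr \<alpha> - v powr \<alpha>) / \<alpha>) = of_real (X u - X v)" for u v
    by (simp add: \<kappa> X_def right_diff_distrib diff_divide_distrib)
  have R: "V_remainder K \<alpha> H n f e s
      = of_real (F 0 s - (\<Sum>k\<le>m. F k e / fact k * (X s - X e) ^ k))" for e s
    unfolding V_remainder_def X_diff using False
    by (simp add: nm F_def atLeast0AtMost)
  have G: "g s = of_real (F (Suc m) s / fact (Suc m) * (X t - X s) ^ Suc m)" for s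
    unfolding g X_diff nm(2) by (simp add: F_def del: power_Suc funpow.simps fact_Suc)
  have "((\<lambda>s. F (Suc m) s / fact (Suc m) * (X t - X s) ^ Suc m * w s) has_integral
      integral {a..b} (\<lambda>s. F 0 s * w s)
        + (taylor_primitive m F X b t - taylor_primitive m F X a t)) {a..b}"
    using assms(15-17) by (intro has_integral_highest_taylor_term contX X contF F int) auto
  note g_int = has_integral_weighted_imp_omega[OF this[unfolded w_def] \<kappa>0 G, folded w_def \<kappa>]
  have "((\<lambda>s. (F 0 s - (\<Sum>k\<le>m. F k a / fact k * (X s - X a) ^ k)) * w s) has_integral
      integral {a..t} (\<lambda>s. F 0 s * w s)
        - (taylor_primitive m F X a t - taylor_primitive m F X a a)) {a..t}"
    using assms(15-17) by (intro has_integral_taylor_remainder contX1 X int1) auto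
  note a_int = has_integral_weighted_imp_omega[OF this[unfolded w_def] \<kappa>0 R, folded w_def \<kappa>]
  have "((\<lambda>s. (F 0 s - (\<Sum>k\<le>m. F k b / fact k * (X s - X b) ^ k)) * w s) has_integral
      integral {t..b} (\<lambda>s. F 0 s * w s)
        - (taylor_primitive m F X b b - taylor_primitive m F X b t)) {t..b}"
    using assms(15-17) by (intro has_integral_taylor_remainder contX1 X int1) auto
  note b_int = has_integral_weighted_imp_omega[OF this[unfolded w_def] \<kappa>0 R, folded w_def \<kappa>]
  \<comment> \<open>A primitive whose endpoint is its centre vanishes, so the remainder integrals
    contribute -P(a) and P(b) besides the two pieces of the integral of \<open>f\<close>, which
    recombine over \<open>{a..b}\<close>.\<close>
  show ?thesis
    using g_int a_int b_int
      Henstock_Kurzweil_Integration.integral_combine[OF assms(16,17) int]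
    by (simp flip: of_real_add of_real_diff)
qed

end
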